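(* Let $c\in(0,1)$ be a constant. For each $n$, let $f(x)=\sum_{i=1}^n a_i x_i$ with integer weights $a_1\ge\dots\ge a_n>0$. Consider Algorithm 1 on $f$ with fitness-proportionate selection, bitwise mutation with rate $\chi/n$ where $\chi=(1-c)/(na_1)$, and population size $\lambda$ satisfying $\lambda\ge c' n^2a_1^2\ln(na_1)$ and $\lambda=O((na_1)^K)$, where $c'$ and $K$ are sufficiently large positive constants. Then the expected runtime is $$E[T]=O\!\left(n^2a_1\lambda\log(na_1)+n^3a_1^2\right).$$
   Context: Algorithm 1 (non-elitist EA): the search space is $\mathcal X=\{0,1\}^n$; the initial population $P_0\in\mathcal X^\lambda$ is sampled uniformly at random. In each generation $t$, the new population $P_{t+1}$ is formed by $\lambda$ independent repetitions of: sample an index $I=\mathrm{sel}(P_t)\in[\lambda]$ by the selection mechanism and set the offspring to $\mathrm{mutate}(P_t(I))$. Fitness-proportionate selection selects index $i$ with probability $f(P(i))/\sum_{j=1}^\lambda f(P(j))$ (convention: uniform if all fitnesses are $0$). Bitwise mutation with rate $\chi/n$ flips each bit independently with probability $\chi/n$. The runtime is $T:=\min\{t\lambda : P_t \text{ contains an optimum of } f\}$. Asymptotic notation is with respect to $n\to\infty$. *)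

theory Defs
  imports "HOL-Probability.Probability"
begin

text \<open>Linear function f(x) = sum a_i x_i (indices shifted to 0..n-1).\<close>
definition lin_fitness :: "(nat \<Rightarrow> nat) \<Rightarrow> bool list \<Rightarrow> nat" where
  "lin_fitness a x = (\<Sum>i<length x. if x ! i then a i else 0)"

fun mutate :: "real \<Rightarrow> bool list \<Rightarrow> bool list pmf" where
  "mutate p [] = return_pmf []"
| "mutate p (b # bs) =
     bind_pmf (bernoulli_pmf p) (\<lambda>fl. bind_pmf (mutate p bs)
       (\<lambda>rest. return_pmf ((if fl then \<not> b else b) # rest)))"

fun iid_list :: "nat \<Rightarrow> 'a pmf \<Rightarrow> 'a list pmf" where
  "iid_list 0 p = return_pmf []"
| "iid_list (Suc k) p = bind_pmf p (\<lambda>x. bind_pmf (iid_list k p) (\<lambda>xs. return_pmf (x # xs)))"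

definition fp_select :: "('b \<Rightarrow> nat) \<Rightarrow> 'b list \<Rightarrow> nat pmf" where
  "fp_select f P =
     (if (\<Sum>i<length P. f (P ! i)) = 0 then pmf_of_set {..<length P}
      else pmf_of_multiset (\<Sum>i<length P. replicate_mset (f (P ! i)) i))"

definition ea_step :: "(bool list \<Rightarrow> nat) \<Rightarrow> real \<Rightarrow> bool list list \<Rightarrow> bool list list pmf" where
  "ea_step f p P = iid_list (length P) (bind_pmf (fp_select f P) (\<lambda>i. mutate p (P ! i)))"

definition init_pop :: "nat \<Rightarrow> nat \<Rightarrow> bool list list pmf" where
  "init_pop n lam = iid_list lam (pmf_of_set {x. length x = n})"

definition is_optimum :: "nat \<Rightarrow> (bool list \<Rightarrow> nat) \<Rightarrow> bool list \<Rightarrow> bool" where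
  "is_optimum n f x \<longleftrightarrow> length x = n \<and> (\<forall>y. length y = n \<longrightarrow> f y \<le> f x)"

definition has_opt :: "nat \<Rightarrow> (bool list \<Rightarrow> nat) \<Rightarrow> bool list list \<Rightarrow> bool" where
  "has_opt n f P \<longleftrightarrow> (\<exists>x\<in>set P. is_optimum n f x)"

text \<open>Stopped chain: state (P_t, min(G,t)) where G is the first generation whose population
  contains an optimum. Then T = lam * G and lam * min(G,t) = min(T, t*lam).\<close>
fun ea_chain :: "nat \<Rightarrow> (bool list \<Rightarrow> nat) \<Rightarrow> real \<Rightarrow> nat \<Rightarrow> nat \<Rightarrow> (bool list list \<times> nat) pmf" where
  "ea_chain n f p lam 0 = map_pmf (\<lambda>P. (P, 0)) (init_pop n lam)"
| "ea_chain n f p lam (Suc t) = bind_pmf (ea_chain n f p lam t)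
     (\<lambda>(P, k). if has_opt n f P then return_pmf (P, k)
               else map_pmf (\<lambda>Q. (Q, Suc k)) (ea_step f p P))"

text \<open>E[T] = sup_t E[min(T, t*lam)] (monotone convergence), as an extended nonneg. real.\<close>
definition expected_runtime :: "nat \<Rightarrow> (bool list \<Rightarrow> nat) \<Rightarrow> real \<Rightarrow> nat \<Rightarrow> ennreal" where
  "expected_runtime n f p lam =
     (SUP t. \<integral>\<^sup>+ s. ennreal (real lam * real (snd s)) \<partial>measure_pmf (ea_chain n f p lam t))"

end

theory Submission
  imports Defs
begin

text \<open>
  Let level k consist of the points of fitness at least a_1 + ... + a_k, and call k the current level
  of a population if it is the largest level reached by a c/4 fraction of the individuals. With M = n a_1
  and \<delta> = c / (8 M), the individuals above the current level, X in number, beat all others in fitness by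
  a factor of at least 1 + 1/M, while mutation changes only a fraction (1 - c)/M of the copies. Hence the number X'
  of such individuals in the next generation is binomial with mean at least (1 + \<delta>) X + z, where
  the immigration z comes from flipping one good bit of an individual on the current level.

  For a binomial X' the expectation of exp (- \<theta> X') is at most exp (- (1 + \<delta>/2) \<theta> X) whenever
  \<theta> \<le> \<delta>/2. Summing such exponentials over a geometric progression of \<theta> ending in \<theta> = \<delta>/2, where
  the immigration gives an extra factor, yields a potential of size O(log (lambda) / \<delta>) that
  decreases by a constant in expectation until level k + 1 becomes the current one. Since
  lambda \<delta>^2 is at least of order log M, losing the current level is so unlikely that it does not
  affect the drift. Additive drift over the n levels gives O(n M log M) generations. The term
  n^3 a_1^2 of the bound is dominated by the other one, since lambda is at least of order M^2 log M.
\<close>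

lemma exp_minus_le_quadratic:
  fixes x :: real
  assumes "0 \<le> x"
  shows "exp (- x) \<le> 1 - x + x\<^sup>2 / 2"
proof -
  have pos: "0 < 1 + x + x\<^sup>2 / 2"
    using assms by (simp add: add_pos_nonneg)
  have "exp (- x) = 1 / exp x"
    by (simp add: exp_minus divide_inverse)
  also have "\<dots> \<le> 1 / (1 + x + x\<^sup>2 / 2)"
    using exp_lower_Taylor_quadratic[OF assms] pos by (intro divide_left_mono) auto
  also have "\<dots> \<le> 1 - x + x\<^sup>2 / 2"
  proof -
    have "(1 - x + x\<^sup>2 / 2) * (1 + x + x\<^sup>2 / 2) = 1 + x ^ 4 / 4"
      by (simp add: field_simps power2_eq_square power4_eq_xxxx)
    also have "\<dots> \<ge> 1" by simp
    finally show ?thesis using pos by (simp add: divide_le_eq)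
  qed
  finally show ?thesis .
qed

lemma length_mutate: "y \<in> set_pmf (mutate p x) \<Longrightarrow> length y = length x"
  by (induction x arbitrary: y) auto

lemma pmf_mutate_Cons:
  assumes "0 \<le> p" "p \<le> 1"
  shows "pmf (mutate p (b # bs)) (b' # bs') = (if b = b' then 1 - p else p) * pmf (mutate p bs) bs'"
proof -
  have *: "pmf (bind_pmf (mutate p bs) (\<lambda>rest. return_pmf (d # rest))) (b' # bs') =
      (if d = b' then pmf (mutate p bs) bs' else 0)" for d
  proof (cases "d = b'")
    case True
    have "pmf (map_pmf ((#) d) (mutate p bs)) (d # bs') = pmf (mutate p bs) bs'"
      by (intro pmf_map_inj') auto
    then show ?thesis using True by (simp add: map_pmf_def)
  next
    case False
    then have "b' # bs' \<notin> set_pmf (bind_pmf (mutate p bs) (\<lambda>rest. return_pmf (d # rest)))"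
      by auto
    then show ?thesis using False by (simp only: pmf_eq_0_set_pmf[symmetric] if_False)
  qed
  have "pmf (mutate p (b # bs)) (b' # bs') =
      (if (\<not> b) = b' then pmf (mutate p bs) bs' else 0) * p + (if b = b' then pmf (mutate p bs) bs' else 0) * (1 - p)"
    using assms
    by (simp only: mutate.simps(2) pmf_bind[of "bernoulli_pmf p"] integral_bernoulli_pmf * if_True if_False real_scaleR_def)
  then show ?thesis by (auto simp: mult.commute)
qed

lemma pmf_mutate_refl:
  assumes "0 \<le> p" "p \<le> 1"
  shows "pmf (mutate p x) x = (1 - p) ^ length x"
  by (induction x) (auto simp: pmf_mutate_Cons[OF assms] simp del: mutate.simps(2))

lemma pmf_mutate_flip:
  assumes "0 \<le> p" "p \<le> 1" "i < length x"
  shows "pmf (mutate p x) (x[i := \<not> x ! i]) = p * (1 - p) ^ (length x - 1)"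
  using assms(3)
proof (induction x arbitrary: i)
  case (Cons b bs)
  show ?case
  proof (cases i)
    case 0
    then show ?thesis
      by (simp add: pmf_mutate_Cons[OF assms(1,2)] pmf_mutate_refl[OF assms(1,2)] del: mutate.simps(2))
  next
    case (Suc k)
    with Cons.prems have k: "k < length bs" by simp
    then have "(1 - p) ^ length bs = (1 - p) * (1 - p) ^ (length bs - 1)"
      by (cases bs) auto
    then show ?thesis using Suc Cons.IH[OF k]
      by (simp add: pmf_mutate_Cons[OF assms(1,2)] del: mutate.simps(2))
  qed
qed simp

lemma set_pmf_iid_list:
  "set_pmf (iid_list k p) = {xs. length xs = k \<and> set xs \<subseteq> set_pmf p}"
proof (induction k)
  case (Suc k)
  then show ?case by (auto simp: length_Suc_conv)
qed auto

lemma count_sum_replicate_mset: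
  fixes m :: nat
  shows
  "count (\<Sum>i<m. replicate_mset (g i) i) j = (if j < m then g j else 0)"
  by (simp add: count_sum)

lemma set_mset_sum_replicate_mset:
  fixes m :: nat
  shows "set_mset (\<Sum>i<m. replicate_mset (g i) i) \<subseteq> {..<m}"
proof
  fix j assume "j \<in># (\<Sum>i<m. replicate_mset (g i) i)"
  then have "count (\<Sum>i<m. replicate_mset (g i) i) j \<noteq> 0" by (simp only: count_eq_zero_iff not_not)
  then show "j \<in> {..<m}" by (simp add: count_sum_replicate_mset split: if_splits)
qed

lemma sum_replicate_mset_nonempty:
  fixes g :: "'a \<Rightarrow> nat"
  assumes "(\<Sum>i\<in>A. g i) \<noteq> 0"
  shows "(\<Sum>i\<in>A. replicate_mset (g i) i) \<noteq> {#}"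
proof -
  have "size (\<Sum>i\<in>A. replicate_mset (g i) i) = (\<Sum>i\<in>A. g i)" by simp
  with assms show ?thesis unfolding size_eq_0_iff_empty[symmetric] by argo
qed

lemma measure_pmf_fp_select:
  assumes "(\<Sum>i<length P. f (P ! i)) \<noteq> 0"
  shows "measure (fp_select f P) {i. Q (P ! i)} =
    (\<Sum>i | i < length P \<and> Q (P ! i). real (f (P ! i))) / (\<Sum>i<length P. real (f (P ! i)))"
proof -
  define M where "M = (\<Sum>i<length P. replicate_mset (f (P ! i)) i)"
  have size: "size M = (\<Sum>i<length P. f (P ! i))" by (simp add: M_def)
  have ne: "M \<noteq> {#}" unfolding M_def by (rule sum_replicate_mset_nonempty[OF assms])
  have count: "count M i = (if i < length P then f (P ! i) else 0)" for i
    unfolding M_def by (rule count_sum_replicate_mset)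
  have "set_mset M \<subseteq> {..<length P}"
    unfolding M_def by (rule set_mset_sum_replicate_mset)
  then have "measure (pmf_of_multiset M) {i. Q (P ! i)} =
      measure (pmf_of_multiset M) {i. i < length P \<and> Q (P ! i)}"
    using ne by (intro measure_pmf.finite_measure_eq_AE) (auto simp: AE_measure_pmf_iff)
  also have "\<dots> = (\<Sum>i | i < length P \<and> Q (P ! i). real (f (P ! i))) / (\<Sum>i<length P. real (f (P ! i)))"
    using ne by (simp add: measure_measure_pmf_finite count size sum_divide_distrib)
  finally show ?thesis using assms by (simp only: fp_select_def M_def if_False)
qed

lemma set_pmf_fp_select:
  assumes "P \<noteq> []"
  shows "set_pmf (fp_select f P) \<subseteq> {..<length P}"
proof (cases "(\<Sum>i<length P. f (P ! i)) = 0")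
  case True
  then show ?thesis using assms by (simp add: fp_select_def lessThan_empty_iff)
next
  case False
  then show ?thesis
    using set_mset_sum_replicate_mset[of "\<lambda>i. f (P ! i)" "length P"]
    by (simp only: fp_select_def if_False set_pmf_of_multiset[OF sum_replicate_mset_nonempty[OF False]])
qed

lemma nn_integral_iid_list_exp_count:
  fixes p :: "'a pmf" and r \<theta> :: real
  assumes "r \<le> measure p {x. Q x}" "0 \<le> \<theta>" "0 \<le> r"
  shows "(\<integral>\<^sup>+ xs. ennreal (exp (- \<theta> * real (length (filter Q xs)))) \<partial>iid_list k p)
    \<le> ennreal (exp (- (1 - exp (- \<theta>)) * (real k * r)))"
proof -
  let ?b = "exp (- (1 - exp (- \<theta>)) * r)"
  define s where "s = measure p {x. Q x}"
  have s: "r \<le> s" "s \<le> 1" using assms(1) by (auto simp: s_def)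
  have e: "exp (- \<theta>) \<le> 1" using assms(2) by simp
  have one: "(\<integral>\<^sup>+ x. ennreal (if Q x then exp (- \<theta>) else 1) \<partial>p) \<le> ennreal ?b"
  proof -
    have "(\<integral>\<^sup>+ x. ennreal (if Q x then exp (- \<theta>) else 1) \<partial>p) =
       (\<integral>\<^sup>+ x. ennreal (exp (- \<theta>)) * indicator {x. Q x} x + indicator {x. \<not> Q x} x \<partial>p)"
      by (intro nn_integral_cong) (auto simp: indicator_def)
    also have "\<dots> = ennreal (exp (- \<theta>)) * emeasure p {x. Q x} + emeasure p {x. \<not> Q x}"
      by (simp add: nn_integral_add nn_integral_cmult)
    also have "emeasure p {x. \<not> Q x} = ennreal (1 - s)"
      using measure_pmf.prob_compl[of "{x. Q x}" p]
      by (simp add: measure_pmf.emeasure_eq_measure s_def Compl_eq_Diff_UNIV[symmetric] Collect_neg_eq)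
    also have "emeasure p {x. Q x} = ennreal s"
      by (simp add: measure_pmf.emeasure_eq_measure s_def)
    also have "ennreal (exp (- \<theta>)) * ennreal s + ennreal (1 - s) = ennreal (1 - (1 - exp (- \<theta>)) * s)"
      using s assms by (simp add: ennreal_mult[symmetric] ennreal_plus[symmetric] algebra_simps del: ennreal_plus)
    also have "\<dots> \<le> ennreal ?b"
    proof (rule ennreal_leI)
      have "1 - (1 - exp (- \<theta>)) * s \<le> 1 - (1 - exp (- \<theta>)) * r"
        using s e by (simp add: mult_left_mono)
      also have "\<dots> \<le> ?b"
        using exp_ge_add_one_self[of "- (1 - exp (- \<theta>)) * r"] by (simp add: algebra_simps)
      finally show "1 - (1 - exp (- \<theta>)) * s \<le> ?b" .
    qed
    finally show ?thesis .
  qed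
  have "(\<integral>\<^sup>+ xs. ennreal (exp (- \<theta> * real (length (filter Q xs)))) \<partial>iid_list k p) \<le> ennreal ?b ^ k"
  proof (induction k)
    case (Suc k)
    have "(\<integral>\<^sup>+ xs. ennreal (exp (- \<theta> * real (length (filter Q xs)))) \<partial>iid_list (Suc k) p) =
      (\<integral>\<^sup>+ x. \<integral>\<^sup>+ xs. ennreal (if Q x then exp (- \<theta>) else 1) *
        ennreal (exp (- \<theta> * real (length (filter Q xs)))) \<partial>iid_list k p \<partial>p)"
      by (simp, intro nn_integral_cong)
        (auto simp: ennreal_mult[symmetric] exp_add[symmetric] algebra_simps)
    also have "\<dots> = (\<integral>\<^sup>+ x. ennreal (if Q x then exp (- \<theta>) else 1) \<partial>p) *
        (\<integral>\<^sup>+ xs. ennreal (exp (- \<theta> * real (length (filter Q xs)))) \<partial>iid_list k p)"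
      by (simp add: nn_integral_cmult nn_integral_multc)
    also have "\<dots> \<le> ennreal ?b * ennreal ?b ^ k"
      by (intro mult_mono one Suc) auto
    finally show ?case by simp
  qed simp
  also have "ennreal ?b ^ k = ennreal (exp (- (1 - exp (- \<theta>)) * (real k * r)))"
    by (simp add: ennreal_power exp_of_nat_mult[symmetric] algebra_simps)
  finally show ?thesis .
qed

lemma nn_integral_iid_list_exp_count_growth:
  fixes p :: "'a pmf" and \<delta> \<theta> x z :: real
  assumes r: "(1 + \<delta>) * x + z \<le> real k * measure p {y. Q y}"
    and \<delta>: "0 < \<delta>" "\<delta> \<le> 1" and \<theta>: "0 \<le> \<theta>" "\<theta> \<le> \<delta> / 2" and x: "0 \<le> x" "0 \<le> z" and k: "0 < k"
  shows "(\<integral>\<^sup>+ xs. ennreal (exp (- \<theta> * real (length (filter Q xs)))) \<partial>iid_list k p)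
    \<le> ennreal (exp (- (1 + \<delta> / 2) * \<theta> * x - \<theta> / 2 * z))"
proof -
  have e: "\<theta> * (1 - \<theta> / 2) \<le> 1 - exp (- \<theta>)"
    using exp_minus_le_quadratic[OF \<theta>(1)] by (simp add: power2_eq_square algebra_simps)
  have "\<theta> * (1 + \<delta> / 2) \<le> \<theta> * ((1 + \<delta>) * (1 - \<theta> / 2))"
  proof (rule mult_left_mono[OF _ \<theta>(1)])
    have "(1 + \<delta>) * \<theta> \<le> 2 * (\<delta> / 2)" using \<theta> \<delta> by (intro mult_mono) auto
    then show "1 + \<delta> / 2 \<le> (1 + \<delta>) * (1 - \<theta> / 2)" by (simp add: field_simps)
  qed
  also have "\<dots> = (1 + \<delta>) * (\<theta> * (1 - \<theta> / 2))" by simp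
  also have "\<dots> \<le> (1 + \<delta>) * (1 - exp (- \<theta>))"
    using e \<delta> by (intro mult_left_mono) auto
  finally have 1: "(1 + \<delta> / 2) * \<theta> * x \<le> (1 - exp (- \<theta>)) * ((1 + \<delta>) * x)"
    using mult_right_mono[OF _ x(1)] by (fastforce simp: algebra_simps)
  have "\<theta> * (1 / 2) \<le> \<theta> * (1 - \<theta> / 2)"
    using \<theta> \<delta> by (intro mult_left_mono) auto
  then have "\<theta> / 2 \<le> 1 - exp (- \<theta>)" using e by simp
  then have 2: "\<theta> / 2 * z \<le> (1 - exp (- \<theta>)) * z" using x by (intro mult_right_mono)
  have "(\<integral>\<^sup>+ xs. ennreal (exp (- \<theta> * real (length (filter Q xs)))) \<partial>iid_list k p)
    \<le> ennreal (exp (- (1 - exp (- \<theta>)) * (real k * (((1 + \<delta>) * x + z) / k))))"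
    using assms by (intro nn_integral_iid_list_exp_count) (auto simp: divide_le_eq mult.commute)
  also have "\<dots> \<le> ennreal (exp (- (1 + \<delta> / 2) * \<theta> * x - \<theta> / 2 * z))"
  proof (rule ennreal_leI)
    have "real k * (((1 + \<delta>) * x + z) / k) = (1 + \<delta>) * x + z" using k by simp
    then show "exp (- (1 - exp (- \<theta>)) * (real k * (((1 + \<delta>) * x + z) / k)))
        \<le> exp (- (1 + \<delta> / 2) * \<theta> * x - \<theta> / 2 * z)"
      using 1 2 by (simp add: algebra_simps)
  qed
  finally show ?thesis .
qed

lemma emeasure_iid_list_count_less:
  fixes p :: "'a pmf" and \<delta> x :: real
  assumes r: "(1 + \<delta>) * x \<le> real k * measure p {y. Q y}"
    and \<delta>: "0 < \<delta>" "\<delta> \<le> 1" and x: "0 \<le> x" and k: "0 < k"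
  shows "emeasure (iid_list k p) {xs. real (length (filter Q xs)) < x} \<le> ennreal (exp (- (\<delta>\<^sup>2 * x / 4)))"
proof -
  let ?e = "\<lambda>xs. ennreal (exp (- (\<delta> / 2) * real (length (filter Q xs))))"
  have "emeasure (iid_list k p) {xs. real (length (filter Q xs)) < x} =
      (\<integral>\<^sup>+ xs. indicator {xs. real (length (filter Q xs)) < x} xs \<partial>iid_list k p)" by simp
  also have "\<dots> \<le> (\<integral>\<^sup>+ xs. ennreal (exp (\<delta> / 2 * x)) * ?e xs \<partial>iid_list k p)"
  proof (rule nn_integral_mono)
    fix xs
    have "\<delta> * real (length (filter Q xs)) \<le> \<delta> * x" if "real (length (filter Q xs)) < x"
      using \<delta> that by simp
    then show "indicator {xs. real (length (filter Q xs)) < x} xs \<le> ennreal (exp (\<delta> / 2 * x)) * ?e xs"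
      by (auto simp: ennreal_mult[symmetric] exp_add[symmetric] split: split_indicator)
  qed
  also have "\<dots> = ennreal (exp (\<delta> / 2 * x)) * (\<integral>\<^sup>+ xs. ?e xs \<partial>iid_list k p)"
    by (simp add: nn_integral_cmult)
  also have "\<dots> \<le> ennreal (exp (\<delta> / 2 * x)) *
      ennreal (exp (- (1 + \<delta> / 2) * (\<delta> / 2) * x - \<delta> / 2 / 2 * 0))"
    using assms by (intro mult_left_mono nn_integral_iid_list_exp_count_growth) auto
  also have "\<dots> = ennreal (exp (- (\<delta>\<^sup>2 * x / 4)))"
    by (simp add: ennreal_mult[symmetric] exp_add[symmetric] algebra_simps power2_eq_square)
  finally show ?thesis .
qed

text \<open>
  The immigration multiplies the expectation of the last summand by exp (- u); its weight 1 + 1/u is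
  chosen such that (1 + 1/u) exp (- u) \<le> 1/u.
\<close>
definition level_potential :: "real \<Rightarrow> real \<Rightarrow> nat \<Rightarrow> real \<Rightarrow> real" where
  "level_potential \<delta> u N x =
    (\<Sum>k=1..N. exp (- (\<delta> / 2 * (1 / (1 + \<delta> / 2)) ^ k) * x)) + (1 + 1 / u) * exp (- (\<delta> / 2) * x)"

lemma level_potential_nonneg: "0 < u \<Longrightarrow> 0 \<le> level_potential \<delta> u N x"
  by (auto simp: level_potential_def intro!: add_nonneg_nonneg sum_nonneg mult_nonneg_nonneg)

lemma level_potential_zero: "level_potential \<delta> u N 0 = real N + 1 + 1 / u"
  by (simp add: level_potential_def)

lemma level_potential_le_zero:
  assumes "0 < u" "0 \<le> \<delta>" "0 \<le> x"
  shows "level_potential \<delta> u N x \<le> level_potential \<delta> u N 0"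
  unfolding level_potential_def using assms
  by (intro add_mono sum_mono mult_left_mono) auto

lemma level_potential_drift:
  fixes p :: "'a pmf" and \<delta> x z :: real
  assumes r: "(1 + \<delta>) * x + z \<le> real k * measure p {y. Q y}"
    and \<delta>: "0 < \<delta>" "\<delta> \<le> 1" and x: "0 \<le> x" "0 < z" and k: "0 < k" and u: "u = \<delta> * z / 4"
  shows "(\<integral>\<^sup>+ xs. ennreal (level_potential \<delta> u N (real (length (filter Q xs)))) \<partial>iid_list k p)
      + ennreal (exp (- (\<delta> / 2 * (1 / (1 + \<delta> / 2)) ^ N) * x)) \<le> ennreal (level_potential \<delta> u N x)"
proof -
  define s where "s = 1 / (1 + \<delta> / 2)"
  define e where "e i y = exp (- (\<delta> / 2 * s ^ i) * y)" for i and y :: real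
  define X where "X xs = real (length (filter Q xs))" for xs
  have s: "0 < s" "s \<le> 1" "(1 + \<delta> / 2) * s = 1" using \<delta> by (auto simp: s_def)
  have u_pos: "0 < u" using \<delta> x by (simp add: u)
  have pot: "level_potential \<delta> u N y = (\<Sum>i=1..N. e i y) + (1 + 1 / u) * e 0 y" for y
    by (simp add: level_potential_def e_def s_def)
  have e_nonneg: "0 \<le> e i y" for i y by (simp add: e_def)
  have growth: "(\<integral>\<^sup>+ xs. ennreal (e i (X xs)) \<partial>iid_list k p)
    \<le> ennreal (exp (- (1 + \<delta> / 2) * (\<delta> / 2 * s ^ i) * x - (\<delta> / 2 * s ^ i) / 2 * z))" for i
    unfolding e_def X_def
  proof (rule nn_integral_iid_list_exp_count_growth)
    have "s ^ i \<le> 1" using s by (intro power_le_one) auto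
    then show "\<delta> / 2 * s ^ i \<le> \<delta> / 2" using \<delta> by (simp add: mult_left_le)
  qed (use r \<delta> x k s in auto)
  have step: "(\<integral>\<^sup>+ xs. ennreal (e i (X xs)) \<partial>iid_list k p) \<le> ennreal (e (i - 1) x)" if i: "1 \<le> i" for i
  proof -
    obtain i' where i': "i = Suc i'" using i by (cases i) auto
    have "(1 + \<delta> / 2) * (\<delta> / 2 * s ^ i) = \<delta> / 2 * s ^ i' * ((1 + \<delta> / 2) * s)" by (simp add: i')
    also have "\<dots> = \<delta> / 2 * s ^ i'" by (simp only: s mult_1_right)
    finally have eq: "(1 + \<delta> / 2) * (\<delta> / 2 * s ^ i) = \<delta> / 2 * s ^ i'" .
    have "0 \<le> (\<delta> / 2 * s ^ i) / 2 * z" using s \<delta> x by simp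
    then have "exp (- (1 + \<delta> / 2) * (\<delta> / 2 * s ^ i) * x - (\<delta> / 2 * s ^ i) / 2 * z) \<le> e (i - 1) x"
      unfolding minus_mult_left[symmetric] eq by (simp add: e_def i')
    then show ?thesis by (rule order_trans[OF growth ennreal_leI])
  qed
  have last: "ennreal (1 + 1 / u) * (\<integral>\<^sup>+ xs. ennreal (e 0 (X xs)) \<partial>iid_list k p) \<le> ennreal (1 / u * e 0 x)"
  proof -
    have "- (1 + \<delta> / 2) * (\<delta> / 2) * x \<le> - (\<delta> / 2) * x"
      using \<delta> x by (simp add: algebra_simps)
    then have "exp (- (1 + \<delta> / 2) * (\<delta> / 2 * s ^ 0) * x - (\<delta> / 2 * s ^ 0) / 2 * z) \<le> e 0 x * exp (- u)"
      by (simp add: e_def u exp_add[symmetric])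
    then have "(\<integral>\<^sup>+ xs. ennreal (e 0 (X xs)) \<partial>iid_list k p) \<le> ennreal (e 0 x * exp (- u))"
      using growth[of 0] by (meson ennreal_leI order_trans)
    then have "ennreal (1 + 1 / u) * (\<integral>\<^sup>+ xs. ennreal (e 0 (X xs)) \<partial>iid_list k p)
        \<le> ennreal (1 + 1 / u) * ennreal (e 0 x * exp (- u))"
      by (intro mult_left_mono) auto
    also have "\<dots> = ennreal ((1 + 1 / u) * exp (- u) * e 0 x)"
      using u_pos e_nonneg by (subst ennreal_mult[symmetric]) (auto simp: mult_ac)
    also have "\<dots> \<le> ennreal (1 / u * e 0 x)"
    proof (intro ennreal_leI mult_right_mono e_nonneg)
      have "(1 + u) \<le> exp u" by simp
      then have "(1 + u) * exp (- u) \<le> 1" by (simp add: exp_minus field_simps)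
      moreover have "(1 + 1 / u) * exp (- u) = (1 + u) * exp (- u) / u" using u_pos by (simp add: field_simps)
      ultimately show "(1 + 1 / u) * exp (- u) \<le> 1 / u" using u_pos by (simp only: divide_right_mono)
    qed
    finally show ?thesis .
  qed
  have tele: "(\<Sum>i=1..N. e (i - 1) x) + e N x = (\<Sum>i=1..N. e i x) + e 0 x"
    by (induction N) auto
  have "(\<integral>\<^sup>+ xs. ennreal (level_potential \<delta> u N (X xs)) \<partial>iid_list k p) =
     (\<integral>\<^sup>+ xs. (\<Sum>i=1..N. ennreal (e i (X xs))) + ennreal (1 + 1 / u) * ennreal (e 0 (X xs)) \<partial>iid_list k p)"
    using u_pos e_nonneg
    by (intro nn_integral_cong)
       (simp add: pot ennreal_mult[symmetric] sum_nonneg sum_ennreal del: ennreal_plus, simp add: sum_nonneg)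
  also have "\<dots> = (\<Sum>i=1..N. \<integral>\<^sup>+ xs. ennreal (e i (X xs)) \<partial>iid_list k p) +
      ennreal (1 + 1 / u) * (\<integral>\<^sup>+ xs. ennreal (e 0 (X xs)) \<partial>iid_list k p)"
    by (simp add: nn_integral_add nn_integral_sum nn_integral_cmult)
  also have "\<dots> \<le> (\<Sum>i=1..N. ennreal (e (i - 1) x)) + ennreal (1 / u * e 0 x)"
    by (intro add_mono sum_mono step last) auto
  also have "\<dots> = ennreal ((\<Sum>i=1..N. e (i - 1) x) + 1 / u * e 0 x)"
    using u_pos e_nonneg by (simp add: sum_nonneg sum_ennreal)
  finally have "(\<integral>\<^sup>+ xs. ennreal (level_potential \<delta> u N (X xs)) \<partial>iid_list k p) + ennreal (e N x)
      \<le> ennreal ((\<Sum>i=1..N. e (i - 1) x) + 1 / u * e 0 x) + ennreal (e N x)"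
    by (intro add_right_mono)
  also have "\<dots> = ennreal (((\<Sum>i=1..N. e (i - 1) x) + e N x) + 1 / u * e 0 x)"
    using u_pos e_nonneg
    by (subst ennreal_plus[symmetric]) (auto simp: sum_nonneg algebra_simps intro!: add_nonneg_nonneg)
  also have "\<dots> = ennreal (level_potential \<delta> u N x)"
    unfolding tele pot by (simp add: algebra_simps)
  finally show ?thesis by (simp only: X_def e_def s_def)
qed

lemma expected_runtime_le_potential:
  fixes \<Phi> :: "bool list list \<Rightarrow> real" and B \<kappa> :: real
  assumes init: "\<And>P. P \<in> set_pmf (init_pop n lam) \<Longrightarrow> V P"
    and closed: "\<And>P Q. V P \<Longrightarrow> Q \<in> set_pmf (ea_step f p P) \<Longrightarrow> V Q"
    and bound: "\<And>P. V P \<Longrightarrow> \<Phi> P \<le> B"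
    and drift: "\<And>P. V P \<Longrightarrow> \<not> has_opt n f P \<Longrightarrow>
      (\<integral>\<^sup>+ Q. ennreal (\<Phi> Q) \<partial>ea_step f p P) + ennreal \<kappa> \<le> ennreal (\<Phi> P)"
    and \<kappa>: "0 < \<kappa>"
  shows "expected_runtime n f p lam \<le> ennreal (real lam * B / \<kappa>)"
  unfolding expected_runtime_def
proof (rule SUP_least)
  fix t
  let ?G = "\<lambda>s. ennreal (\<kappa> * real (snd s)) + ennreal (\<Phi> (fst s))"
  have V: "\<And>s. s \<in> set_pmf (ea_chain n f p lam t) \<Longrightarrow> V (fst s)" for t
  proof (induction t)
    case 0
    then show ?case using init by auto
  next
    case (Suc t)
    then show ?case using closed by (fastforce split: if_splits)
  qed
  have main: "(\<integral>\<^sup>+ s. ?G s \<partial>ea_chain n f p lam t) \<le> ennreal B"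
  proof (induction t)
    case 0
    have "(\<integral>\<^sup>+ s. ?G s \<partial>ea_chain n f p lam 0) = (\<integral>\<^sup>+ P. ennreal (\<Phi> P) \<partial>init_pop n lam)"
      by simp
    also have "\<dots> \<le> (\<integral>\<^sup>+ P. ennreal B \<partial>init_pop n lam)"
      using init bound by (intro nn_integral_mono_AE) (auto simp: AE_measure_pmf_iff intro!: ennreal_leI)
    finally show ?case by simp
  next
    case (Suc t)
    have "(\<integral>\<^sup>+ s. ?G s \<partial>ea_chain n f p lam (Suc t)) =
      (\<integral>\<^sup>+ s. (\<integral>\<^sup>+ s'. ?G s' \<partial>(case s of (P, k) \<Rightarrow> if has_opt n f P then return_pmf (P, k)
               else map_pmf (\<lambda>Q. (Q, Suc k)) (ea_step f p P))) \<partial>ea_chain n f p lam t)"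
      by simp
    also have "\<dots> \<le> (\<integral>\<^sup>+ s. ?G s \<partial>ea_chain n f p lam t)"
    proof (intro nn_integral_mono_AE, unfold AE_measure_pmf_iff, rule ballI)
      fix s assume s: "s \<in> set_pmf (ea_chain n f p lam t)"
      obtain P k where sP: "s = (P, k)" by force
      have VP: "V P" using V[OF s] sP by simp
      show "(\<integral>\<^sup>+ s'. ?G s' \<partial>(case s of (P, k) \<Rightarrow> if has_opt n f P then return_pmf (P, k)
               else map_pmf (\<lambda>Q. (Q, Suc k)) (ea_step f p P))) \<le> ?G s"
      proof (cases "has_opt n f P")
        case True
        then show ?thesis by (simp add: sP)
      next
        case False
        have "(\<integral>\<^sup>+ s'. ?G s' \<partial>map_pmf (\<lambda>Q. (Q, Suc k)) (ea_step f p P)) =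
          ennreal (\<kappa> * real (Suc k)) + (\<integral>\<^sup>+ Q. ennreal (\<Phi> Q) \<partial>ea_step f p P)"
          by (simp add: nn_integral_add)
        also have "ennreal (\<kappa> * real (Suc k)) = ennreal (\<kappa> * real k) + ennreal \<kappa>"
          using \<kappa> by (subst ennreal_plus[symmetric]) (auto simp: algebra_simps)
        also have "ennreal (\<kappa> * real k) + ennreal \<kappa> + (\<integral>\<^sup>+ Q. ennreal (\<Phi> Q) \<partial>ea_step f p P)
          = ennreal (\<kappa> * real k) + ((\<integral>\<^sup>+ Q. ennreal (\<Phi> Q) \<partial>ea_step f p P) + ennreal \<kappa>)"
          by (simp add: ac_simps)
        also have "\<dots> \<le> ennreal (\<kappa> * real k) + ennreal (\<Phi> P)"
          by (intro add_left_mono drift VP False)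
        finally show ?thesis using False by (simp add: sP)
      qed
    qed
    also have "\<dots> \<le> ennreal B" by (rule Suc)
    finally show ?case .
  qed
  have "(\<integral>\<^sup>+ s. ennreal (real lam * real (snd s)) \<partial>ea_chain n f p lam t) \<le>
    (\<integral>\<^sup>+ s. ennreal (real lam / \<kappa>) * ?G s \<partial>ea_chain n f p lam t)"
  proof (rule nn_integral_mono)
    fix s :: "bool list list \<times> nat"
    have "ennreal (real lam * real (snd s)) = ennreal (real lam / \<kappa>) * ennreal (\<kappa> * real (snd s))"
      using \<kappa> by (subst ennreal_mult[symmetric]) auto
    also have "\<dots> \<le> ennreal (real lam / \<kappa>) * ?G s" by (intro mult_left_mono) auto
    finally show "ennreal (real lam * real (snd s)) \<le> ennreal (real lam / \<kappa>) * ?G s" .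
  qed
  also have "\<dots> = ennreal (real lam / \<kappa>) * (\<integral>\<^sup>+ s. ?G s \<partial>ea_chain n f p lam t)"
    by (simp add: nn_integral_cmult)
  also have "\<dots> \<le> ennreal (real lam / \<kappa>) * ennreal B"
    by (intro mult_left_mono main) auto
  also have "\<dots> = ennreal (real lam * B / \<kappa>)"
    using \<kappa> by (subst ennreal_mult'[symmetric]) auto
  finally show "(\<integral>\<^sup>+ s. ennreal (real lam * real (snd s)) \<partial>ea_chain n f p lam t) \<le> ennreal (real lam * B / \<kappa>)" .
qed

lemma measure_bind_pmf_ge:
  fixes \<alpha> \<beta> :: real and M :: "'a pmf" and N :: "'a \<Rightarrow> 'b pmf"
  assumes "0 \<le> \<alpha>" "0 \<le> \<beta>"
    and "\<And>i. i \<in> set_pmf M \<Longrightarrow> \<alpha> * indicator A i + \<beta> * indicator B i \<le> measure (N i) X"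
  shows "\<alpha> * measure M A + \<beta> * measure M B \<le> measure (bind_pmf M N) X"
proof -
  have "ennreal (\<alpha> * measure M A + \<beta> * measure M B) =
      (\<integral>\<^sup>+ i. ennreal \<alpha> * indicator A i + ennreal \<beta> * indicator B i \<partial>M)"
    using assms(1,2)
    by (simp add: nn_integral_add nn_integral_cmult measure_pmf.emeasure_eq_measure ennreal_mult)
  also have "\<dots> \<le> (\<integral>\<^sup>+ i. emeasure (N i) X \<partial>M)"
  proof (intro nn_integral_mono_AE, unfold AE_measure_pmf_iff, rule ballI)
    fix i assume "i \<in> set_pmf M"
    have "ennreal \<alpha> * indicator A i + ennreal \<beta> * indicator B i
        = ennreal (\<alpha> * indicator A i + \<beta> * indicator B i)"
      using assms(1,2) by (auto split: split_indicator)
    also have "\<dots> \<le> ennreal (measure (N i) X)" using assms(3)[OF \<open>i \<in> _\<close>] by (rule ennreal_leI)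
    finally show "ennreal \<alpha> * indicator A i + ennreal \<beta> * indicator B i \<le> emeasure (N i) X"
      by (simp add: measure_pmf.emeasure_eq_measure)
  qed
  also have "\<dots> = ennreal (measure (bind_pmf M N) X)"
    by (simp add: measure_pmf.emeasure_eq_measure[symmetric])
  finally show ?thesis by simp
qed

lemma lin_fitness_update_True:
  assumes "i < length x" "\<not> x ! i"
  shows "lin_fitness a (x[i := True]) = lin_fitness a x + a i"
proof -
  have "lin_fitness a (x[i := True]) =
      (\<Sum>k<length x. (if x ! k then a k else 0) + (if k = i then a i else 0))"
    unfolding lin_fitness_def using assms by (auto intro!: sum.cong simp: nth_list_update)
  also have "\<dots> = lin_fitness a x + a i"
    using assms(1) by (simp add: sum.distrib lin_fitness_def)
  finally show ?thesis .
qed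

locale fp_ea =
  fixes a :: "nat \<Rightarrow> nat" and n lam :: nat and c :: real
  assumes c: "0 < c" "c < 1"
    and antimono: "\<And>i j. i \<le> j \<Longrightarrow> j < n \<Longrightarrow> a j \<le> a i"
    and pos: "\<And>i. i < n \<Longrightarrow> 0 < a i"
    and n_ge: "8 / c \<le> real n"
    and lam_pos: "0 < lam"
begin

definition "fmax = real n * real (a 0)"
definition "rate = (1 - c) / fmax / real n"
definition "\<delta> = c / (8 * fmax)"
definition "\<gamma> = c / 4"
definition "threshold k = (\<Sum>i<k. a i)"

abbreviation "f \<equiv> lin_fitness a"
abbreviation "reaches k \<equiv> (\<lambda>x. threshold k \<le> f x)"

definition "cnt k P = length (filter (reaches k) P)"
definition "valid P \<longleftrightarrow> length P = lam \<and> (\<forall>x\<in>set P. length x = n)"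
definition "offspring P = bind_pmf (fp_select f P) (\<lambda>i. mutate rate (P ! i))"

lemma n_gt: "8 < real n"
proof -
  have "8 < 8 / c" using c by (simp add: field_simps)
  with n_ge show ?thesis by simp
qed

lemma inverse_n_le: "1 / real n \<le> c / 8"
  using n_ge n_gt c by (simp add: field_simps)

lemma fmax_ge: "real n \<le> fmax"
proof -
  have "1 \<le> real (a 0)" using pos[of 0] n_gt by simp
  then show ?thesis using mult_left_mono[of 1 "real (a 0)" "real n"] by (simp add: fmax_def)
qed

lemma fmax_pos: "0 < fmax" using fmax_ge n_gt by linarith

lemma inverse_fmax_le: "1 / fmax \<le> c / 8"
proof -
  have "1 / fmax \<le> 1 / real n" using fmax_ge n_gt by (intro divide_left_mono) auto
  with inverse_n_le show ?thesis by simp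
qed

lemma rate: "0 < rate" "rate \<le> 1"
proof -
  show "0 < rate" using c fmax_pos n_gt by (simp add: rate_def)
  have "(1 - c) / fmax \<le> 1" using c fmax_ge n_gt by simp
  then have "(1 - c) / fmax \<le> real n" using n_gt by linarith
  then show "rate \<le> 1" unfolding rate_def using n_gt by (subst divide_le_eq_1_pos) auto
qed

lemma \<delta>: "0 < \<delta>" "\<delta> \<le> 1"
  using c fmax_pos fmax_ge n_gt by (auto simp: \<delta>_def)

lemma no_flip_ge: "1 - (1 - c) / fmax \<le> (1 - rate) ^ n"
  using Bernoulli_inequality[of "- rate" n] rate n_gt by (simp add: rate_def)

lemma no_flip_half: "1 / 2 \<le> (1 - rate) ^ n"
proof -
  have "(1 - c) / fmax \<le> 1 / fmax" using c fmax_pos by (simp add: divide_right_mono)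
  with inverse_fmax_le no_flip_ge c show ?thesis by linarith
qed

lemma one_flip_le: "rate * (1 - rate) ^ (n - 1) \<le> rate"
  using rate by (simp add: mult_left_le power_le_one)

lemma one_flip_ge: "rate / 2 \<le> rate * (1 - rate) ^ (n - 1)"
proof -
  have "(1 - rate) ^ n \<le> (1 - rate) ^ (n - 1)" using rate by (intro power_decreasing) auto
  then have "1 / 2 \<le> (1 - rate) ^ (n - 1)" using no_flip_half by linarith
  then show ?thesis using rate by (simp add: field_simps)
qed

lemma selection_beats_mutation:
  "1 + \<delta> \<le> (1 + (1 - \<gamma>) / fmax) * ((1 - rate) ^ n - rate * (1 - rate) ^ (n - 1))"
proof -
  define r where "r = 1 / fmax"
  have r: "0 < r" "r \<le> c / 8" using inverse_fmax_le fmax_pos by (auto simp: r_def)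
  have "rate = r * ((1 - c) * (1 / n))" by (simp add: rate_def r_def)
  also have "\<dots> \<le> r * (1 * (c / 8))"
    using inverse_n_le c r by (intro mult_left_mono mult_mono) auto
  finally have "rate \<le> c * r / 8" by (simp add: mult.commute)
  moreover have "1 - (1 - c) * r \<le> (1 - rate) ^ n" using no_flip_ge by (simp add: r_def)
  moreover have "0 \<le> c * r" using c r by simp
  ultimately have "1 - (1 - c / 2) * r \<le> (1 - rate) ^ n - rate * (1 - rate) ^ (n - 1)"
    using one_flip_le by (simp add: left_diff_distrib)
  then have "(1 + (1 - \<gamma>) * r) * (1 - (1 - c / 2) * r)
      \<le> (1 + (1 - \<gamma>) * r) * ((1 - rate) ^ n - rate * (1 - rate) ^ (n - 1))"
    using c r by (intro mult_left_mono) (auto simp: \<gamma>_def)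
  moreover have "1 + \<delta> \<le> (1 + (1 - \<gamma>) * r) * (1 - (1 - c / 2) * r)"
  proof -
    have "((1 - c / 4) * (1 - c / 2)) * r \<le> 1 * (c / 8)"
      using c r by (intro mult_mono mult_le_one) auto
    then have "((1 - c / 4) * (1 - c / 2)) * r * r \<le> c / 8 * r"
      using r by (intro mult_right_mono) auto
    moreover have "\<delta> = c / 8 * r" by (simp add: \<delta>_def r_def)
    ultimately show ?thesis by (simp add: \<gamma>_def field_simps)
  qed
  ultimately show ?thesis by (simp add: r_def)
qed

lemma threshold_le_fmax: "k \<le> n \<Longrightarrow> real (threshold k) \<le> fmax"
proof -
  assume k: "k \<le> n"
  have "threshold k \<le> (\<Sum>i<k. a 0)" unfolding threshold_def
    using antimono k by (intro sum_mono) auto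
  also have "\<dots> \<le> n * a 0" using k by simp
  finally show ?thesis unfolding fmax_def by (metis of_nat_le_iff of_nat_mult)
qed

lemma threshold_pos: "0 < k \<Longrightarrow> k \<le> n \<Longrightarrow> 0 < threshold k"
  using pos unfolding threshold_def by (intro sum_pos) (auto simp: lessThan_empty_iff)

lemma cnt_card: "length P = lam \<Longrightarrow> cnt k P = card {i. i < lam \<and> reaches k (P ! i)}"
  by (simp add: cnt_def length_filter_conv_card)

lemma cnt_zero: "valid P \<Longrightarrow> cnt 0 P = lam"
  by (simp add: cnt_def threshold_def valid_def)

lemma select_reaches_ge:
  assumes P: "valid P" and k: "0 < k" "k \<le> n" and g: "0 \<le> g" "g \<le> \<gamma>" and cnt: "g * real lam \<le> real (cnt k P)"
  shows "g * (1 + (1 - \<gamma>) / fmax) \<le> measure (fp_select f P) {i. reaches k (P ! i)}"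
proof -
  define F where "F = real (threshold k)"
  define I where "I = {i. i < lam \<and> reaches k (P ! i)}"
  define X where "X = real (cnt k P)"
  define W where "W = (\<Sum>i\<in>I. real (f (P ! i)))"
  define U where "U = (\<Sum>i\<in>{..<lam} - I. real (f (P ! i)))"
  have len: "length P = lam" using P by (simp add: valid_def)
  have F: "1 \<le> F" "F \<le> fmax" using threshold_pos[OF k] threshold_le_fmax[OF k(2)] by (auto simp: F_def)
  have I: "finite I" "I \<subseteq> {..<lam}" by (auto simp: I_def)
  have X: "X = real (card I)" by (simp add: X_def I_def cnt_card len)
  have W: "X * F \<le> W"
    unfolding W_def X F_def by (rule sum_bounded_below) (auto simp: I_def)
  have "U \<le> real (card ({..<lam} - I)) * (F - 1)"
    unfolding U_def by (rule sum_bounded_above) (auto simp: I_def F_def)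
  also have "real (card ({..<lam} - I)) = real lam - X"
    using I card_mono[OF _ I(2)] by (simp add: card_Diff_subset X of_nat_diff)
  finally have U: "U \<le> (real lam - X) * (F - 1)" .
  have S: "(\<Sum>i<lam. real (f (P ! i))) = W + U"
    unfolding W_def U_def using sum.subset_diff[OF I(2), of "\<lambda>i. real (f (P ! i))"] by simp
  show ?thesis
  proof (cases "(\<Sum>i<lam. f (P ! i)) = 0")
    case True
    then have "I = {}" using threshold_pos[OF k] by (auto simp: I_def)
    then have "g * real lam \<le> 0" using cnt X by (simp add: X_def)
    then have "g = 0" using g lam_pos by (simp add: mult_le_0_iff)
    then show ?thesis by simp
  next
    case False
    define \<eta> where "\<eta> = (1 - \<gamma>) / fmax"
    have \<gamma>: "\<gamma> \<le> 1 / 4" "0 < \<gamma>" using c by (auto simp: \<gamma>_def)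
    have \<eta>: "0 \<le> \<eta>" "\<eta> * fmax = 1 - \<gamma>" using \<gamma> fmax_pos by (auto simp: \<eta>_def)
    have \<eta>1: "\<eta> \<le> 1" unfolding \<eta>_def using \<gamma> fmax_ge n_gt by simp
    have "(\<Sum>i<lam. real (f (P ! i))) = real (\<Sum>i<lam. f (P ! i))" by simp
    with False S have "W + U \<noteq> 0" by (metis of_nat_eq_0_iff)
    moreover have "0 \<le> W" "0 \<le> U" by (auto simp: W_def U_def sum_nonneg)
    ultimately have pos: "0 < W + U" by linarith
    have g1: "g * (1 + \<eta>) \<le> 1"
    proof -
      have "g * (1 + \<eta>) \<le> (1 / 4) * (1 + 1)" using g \<gamma> \<eta> \<eta>1 by (intro mult_mono) auto
      then show ?thesis by simp
    qed
    have key: "\<eta> * (F - 1 + g) \<le> 1 - g"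
    proof -
      have "\<eta> * (F - 1 + g) \<le> \<eta> * fmax" using F g \<gamma> \<eta> by (intro mult_left_mono) auto
      with \<eta> g show ?thesis by simp
    qed
    have "g * (1 + \<eta>) * U \<le> g * (1 + \<eta>) * ((1 - g) * real lam * (F - 1))"
    proof (intro mult_left_mono)
      have "(real lam - X) * (F - 1) \<le> ((1 - g) * real lam) * (F - 1)"
        using F cnt by (intro mult_right_mono) (auto simp: X_def algebra_simps)
      with U show "U \<le> (1 - g) * real lam * (F - 1)" by simp
    qed (use g \<eta> in auto)
    also have "\<dots> = (g * real lam) * ((1 + \<eta>) * (1 - g) * (F - 1))" by simp
    also have "\<dots> \<le> (g * real lam) * (F * (1 - g * (1 + \<eta>)))"
      using key g by (intro mult_left_mono) (auto simp: algebra_simps)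
    also have "\<dots> = (g * real lam * F) * (1 - g * (1 + \<eta>))" by simp
    also have "\<dots> \<le> W * (1 - g * (1 + \<eta>))"
    proof (intro mult_right_mono)
      have "g * real lam * F \<le> X * F" using cnt F by (intro mult_right_mono) (auto simp: X_def)
      with W show "g * real lam * F \<le> W" by simp
    qed (use g1 in auto)
    finally have "g * (1 + \<eta>) * (W + U) \<le> W" by (simp add: algebra_simps)
    then have "g * (1 + \<eta>) \<le> W / (W + U)" using pos by (simp add: pos_le_divide_eq)
    also have "\<dots> = measure (fp_select f P) {i. reaches k (P ! i)}"
      using measure_pmf_fp_select[of f P "reaches k"] False S by (simp add: len W_def I_def)
    finally show ?thesis by (simp add: \<eta>_def)
  qed
qed

lemma mutate_keeps_level:
  assumes "length x = n" "reaches k x"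
  shows "(1 - rate) ^ n \<le> measure (mutate rate x) {y. reaches k y}"
proof -
  have "(1 - rate) ^ n = measure (mutate rate x) {x}"
    using pmf_mutate_refl[of rate x] rate assms by (simp add: measure_pmf_single)
  also have "\<dots> \<le> measure (mutate rate x) {y. reaches k y}"
    using assms by (intro measure_pmf.finite_measure_mono) auto
  finally show ?thesis .
qed

lemma mutate_improves_level:
  assumes len: "length x = n" and j: "j < n" and x: "reaches j x" "\<not> reaches (Suc j) x"
  shows "rate * (1 - rate) ^ (n - 1) \<le> measure (mutate rate x) {y. reaches (Suc j) y}"
proof -
  have "\<exists>i\<le>j. \<not> x ! i"
  proof (rule ccontr)
    assume "\<not> ?thesis"
    then have "threshold (Suc j) = (\<Sum>i<Suc j. if x ! i then a i else 0)"
      unfolding threshold_def by (intro sum.cong) auto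
    also have "\<dots> \<le> f x" unfolding lin_fitness_def using j len by (intro sum_mono2) auto
    finally show False using x by simp
  qed
  then obtain i where i: "i \<le> j" "\<not> x ! i" by auto
  have "f (x[i := True]) = f x + a i"
    using i j len by (intro lin_fitness_update_True) auto
  moreover have "a j \<le> a i" using antimono i j by auto
  ultimately have up: "reaches (Suc j) (x[i := True])" using x by (simp add: threshold_def)
  have "rate * (1 - rate) ^ (n - 1) = measure (mutate rate x) {x[i := True]}"
    using pmf_mutate_flip[of rate i x] rate len i j by (simp add: measure_pmf_single)
  also have "\<dots> \<le> measure (mutate rate x) {y. reaches (Suc j) y}"
    using up by (intro measure_pmf.finite_measure_mono) auto
  finally show ?thesis .
qed

lemma valid_selected:
  assumes "valid P" "i \<in> set_pmf (fp_select f P)"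
  shows "length (P ! i) = n"
proof -
  have "P \<noteq> []" using assms lam_pos by (auto simp: valid_def)
  then have "i < length P" using set_pmf_fp_select assms(2) by blast
  with assms(1) show ?thesis by (auto simp: valid_def)
qed

lemma offspring_keeps_level:
  assumes "valid P"
  shows "(1 - rate) ^ n * measure (fp_select f P) {i. reaches k (P ! i)}
    \<le> measure (offspring P) {y. reaches k y}"
proof -
  have "(1 - rate) ^ n * measure (fp_select f P) {i. reaches k (P ! i)} + 0 * measure (fp_select f P) {}
    \<le> measure (offspring P) {y. reaches k y}"
    unfolding offspring_def
  proof (rule measure_bind_pmf_ge)
    fix i assume "i \<in> set_pmf (fp_select f P)"
    from mutate_keeps_level[OF valid_selected[OF assms this]]
    show "(1 - rate) ^ n * indicator {i. reaches k (P ! i)} i + 0 * indicator {} i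
      \<le> measure (mutate rate (P ! i)) {y. reaches k y}"
      by (auto split: split_indicator)
  qed (use rate in auto)
  then show ?thesis by simp
qed

lemma one_flip_le_no_flip: "rate * (1 - rate) ^ (n - 1) \<le> (1 - rate) ^ n"
proof -
  have "rate \<le> 1 / real n"
    using c fmax_ge n_gt unfolding rate_def by (intro divide_right_mono) auto
  then show ?thesis using one_flip_le no_flip_half inverse_n_le c by linarith
qed

lemma offspring_improves_level:
  assumes "valid P" "j < n"
  shows "((1 - rate) ^ n - rate * (1 - rate) ^ (n - 1)) * measure (fp_select f P) {i. reaches (Suc j) (P ! i)}
     + rate * (1 - rate) ^ (n - 1) * measure (fp_select f P) {i. reaches j (P ! i)}
    \<le> measure (offspring P) {y. reaches (Suc j) y}"
  unfolding offspring_def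
proof (rule measure_bind_pmf_ge)
  fix i assume i: "i \<in> set_pmf (fp_select f P)"
  note len = valid_selected[OF assms(1) i]
  have "reaches j x" if "reaches (Suc j) x" for x using that by (simp add: threshold_def)
  then show "((1 - rate) ^ n - rate * (1 - rate) ^ (n - 1)) * indicator {i. reaches (Suc j) (P ! i)} i
      + rate * (1 - rate) ^ (n - 1) * indicator {i. reaches j (P ! i)} i
      \<le> measure (mutate rate (P ! i)) {y. reaches (Suc j) y}"
    using mutate_keeps_level[OF len, of "Suc j"] mutate_improves_level[OF len assms(2)]
    by (auto split: split_indicator)
qed (use rate one_flip_le_no_flip in auto)

lemma level_stable:
  assumes P: "valid P" and k: "0 < k" "k \<le> n" and cnt: "\<gamma> * real lam \<le> real (cnt k P)"
  shows "(1 + \<delta>) * (\<gamma> * real lam) \<le> real lam * measure (offspring P) {y. reaches k y}"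
proof -
  let ?q = "(1 - rate) ^ n"
  have "(1 + \<delta>) * \<gamma> \<le> ((1 + (1 - \<gamma>) / fmax) * (?q - rate * (1 - rate) ^ (n - 1))) * \<gamma>"
    using selection_beats_mutation c by (intro mult_right_mono) (auto simp: \<gamma>_def)
  also have "\<dots> = (?q - rate * (1 - rate) ^ (n - 1)) * (\<gamma> * (1 + (1 - \<gamma>) / fmax))" by simp
  also have "\<dots> \<le> ?q * measure (fp_select f P) {i. reaches k (P ! i)}"
    using select_reaches_ge[OF P k _ _ cnt] c rate fmax_pos
    by (intro mult_mono) (auto simp: \<gamma>_def)
  also have "\<dots> \<le> measure (offspring P) {y. reaches k y}" by (rule offspring_keeps_level[OF P])
  finally show ?thesis using lam_pos by (simp add: mult_ac)
qed

lemma next_level_growth: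
  assumes P: "valid P" and j: "j < n" and cnt: "\<gamma> * real lam \<le> real (cnt j P)"
    and lt: "real (cnt (Suc j) P) < \<gamma> * real lam"
  shows "(1 + \<delta>) * real (cnt (Suc j) P) + real lam * (\<gamma> * rate / 2)
    \<le> real lam * measure (offspring P) {y. reaches (Suc j) y}"
proof -
  let ?q = "(1 - rate) ^ n" and ?z = "rate * (1 - rate) ^ (n - 1)"
  let ?w = "\<lambda>k. measure (fp_select f P) {i. reaches k (P ! i)}"
  define g where "g = real (cnt (Suc j) P) / real lam"
  have g: "0 \<le> g" "g \<le> \<gamma>" "g * real lam = real (cnt (Suc j) P)"
    using lt lam_pos by (auto simp: g_def divide_le_eq)
  have \<gamma>: "0 < \<gamma>" "\<gamma> \<le> 1" using c by (auto simp: \<gamma>_def)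
  have wj: "\<gamma> \<le> ?w j"
  proof (cases "j = 0")
    case True
    then show ?thesis using \<gamma> by (simp add: threshold_def)
  next
    case False
    have "\<gamma> * 1 \<le> \<gamma> * (1 + (1 - \<gamma>) / fmax)" using \<gamma> fmax_pos by (intro mult_left_mono) auto
    also have "\<dots> \<le> ?w j" using False j \<gamma> cnt by (intro select_reaches_ge P) auto
    finally show ?thesis by simp
  qed
  have "(1 + \<delta>) * g \<le> ((1 + (1 - \<gamma>) / fmax) * (?q - ?z)) * g"
    using selection_beats_mutation g by (intro mult_right_mono) auto
  also have "\<dots> = (?q - ?z) * (g * (1 + (1 - \<gamma>) / fmax))" by simp
  also have "\<dots> \<le> (?q - ?z) * ?w (Suc j)"
    using j g one_flip_le_no_flip by (intro mult_left_mono select_reaches_ge P) auto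
  finally have 1: "(1 + \<delta>) * g \<le> (?q - ?z) * ?w (Suc j)" .
  have "rate / 2 * \<gamma> \<le> ?z * ?w j" using wj one_flip_ge \<gamma> rate by (intro mult_mono) auto
  with 1 offspring_improves_level[OF P j]
  have "(1 + \<delta>) * g + \<gamma> * rate / 2 \<le> measure (offspring P) {y. reaches (Suc j) y}" by (simp add: mult_ac)
  then have "real lam * ((1 + \<delta>) * g + \<gamma> * rate / 2) \<le> real lam * measure (offspring P) {y. reaches (Suc j) y}"
    by (intro mult_left_mono) auto
  also have "real lam * ((1 + \<delta>) * g + \<gamma> * rate / 2) = (1 + \<delta>) * (g * real lam) + real lam * (\<gamma> * rate / 2)"
    by (simp add: algebra_simps)
  finally show ?thesis by (simp only: g)
qed

lemma valid_init: "P \<in> set_pmf (init_pop n lam) \<Longrightarrow> valid P"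
proof -
  have "finite {x :: bool list. length x = n}" using finite_lists_length_eq[of "UNIV :: bool set" n] by simp
  moreover have "{x :: bool list. length x = n} \<noteq> {}" by (auto intro: exI[of _ "replicate n True"])
  ultimately show "P \<in> set_pmf (init_pop n lam) \<Longrightarrow> valid P"
    by (auto simp: init_pop_def set_pmf_iid_list valid_def)
qed

lemma ea_step_eq: "valid P \<Longrightarrow> ea_step f rate P = iid_list lam (offspring P)"
  by (simp add: ea_step_def offspring_def valid_def)

lemma valid_step:
  assumes "valid P" "Q \<in> set_pmf (ea_step f rate P)"
  shows "valid Q"
  using assms valid_selected[OF assms(1)]
  by (force simp: ea_step_eq set_pmf_iid_list valid_def offspring_def dest!: length_mutate)

lemma no_opt_cnt:
  assumes "valid P" "\<not> has_opt n f P"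
  shows "cnt n P = 0"
proof -
  have max: "f y \<le> threshold n" if "length y = n" for y
    unfolding lin_fitness_def threshold_def that by (intro sum_mono) auto
  have "\<not> reaches n x" if "x \<in> set P" for x
  proof
    assume "reaches n x"
    then have "is_optimum n f x"
      using assms(1) that max unfolding is_optimum_def valid_def by (blast intro: order_trans)
    with that assms(2) show False by (auto simp: has_opt_def)
  qed
  then show ?thesis by (simp add: cnt_def)
qed

definition "level P = Max {k. k \<le> n \<and> \<gamma> * real lam \<le> real (cnt k P)}"

lemma \<gamma>_lam: "0 < \<gamma> * real lam" "\<gamma> * real lam \<le> real lam"
  using c lam_pos by (auto simp: \<gamma>_def)

lemma level:
  assumes "valid P"
  shows "level P \<le> n" "\<gamma> * real lam \<le> real (cnt (level P) P)"
proof -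
  have "level P \<in> {k. k \<le> n \<and> \<gamma> * real lam \<le> real (cnt k P)}"
    unfolding level_def using cnt_zero[OF assms] \<gamma>_lam by (intro Max_in) (auto intro!: exI[of _ 0])
  then show "level P \<le> n" "\<gamma> * real lam \<le> real (cnt (level P) P)" by auto
qed

lemma level_ge: "k \<le> n \<Longrightarrow> \<gamma> * real lam \<le> real (cnt k P) \<Longrightarrow> k \<le> level P"
  unfolding level_def by (intro Max_ge) auto

definition "u = \<delta> * (real lam * (\<gamma> * rate / 2)) / 4"
abbreviation "\<psi> \<equiv> level_potential \<delta> u"
definition "potential N P = real (n - level P) * \<psi> N 0 + \<psi> N (real (cnt (Suc (level P)) P))"

lemma u_pos: "0 < u"
  using \<delta> \<gamma>_lam rate lam_pos c by (simp add: u_def \<gamma>_def)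

lemma \<psi>_bounds: "0 \<le> \<psi> N (real m)" "\<psi> N (real m) \<le> \<psi> N 0" "0 \<le> \<psi> N 0"
  using level_potential_nonneg[OF u_pos] level_potential_le_zero[OF u_pos] \<delta> by auto

lemma potential_le: "potential N P \<le> (real n + 1) * \<psi> N 0"
proof -
  have "real (n - level P) * \<psi> N 0 \<le> real n * \<psi> N 0" using \<psi>_bounds by (intro mult_right_mono) auto
  with \<psi>_bounds(2)[of N "cnt (Suc (level P)) P"] show ?thesis by (simp add: potential_def distrib_right)
qed

lemma potential_le_old_level:
  assumes "j < n"
  shows "potential N Q \<le> real (n - j) * \<psi> N 0 + \<psi> N (real (cnt (Suc j) Q))
    + (real n + 1) * \<psi> N 0 * indicator {Q. real (cnt j Q) < \<gamma> * real lam} Q"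
proof (cases "real (cnt j Q) < \<gamma> * real lam")
  case True
  have "0 \<le> real (n - j) * \<psi> N 0" using \<psi>_bounds by simp
  with True potential_le[of N Q] \<psi>_bounds(1)[of N "cnt (Suc j) Q"] show ?thesis by simp
next
  case False
  then have "j \<le> level Q" using assms by (intro level_ge) auto
  show ?thesis
  proof (cases "level Q = j")
    case True
    with False show ?thesis by (simp add: potential_def)
  next
    case less: False
    with \<open>j \<le> level Q\<close> assms have "real (n - level Q) \<le> real (n - j) - 1" by (auto simp: of_nat_diff)
    then have "real (n - level Q) * \<psi> N 0 \<le> (real (n - j) - 1) * \<psi> N 0"
      using \<psi>_bounds by (intro mult_right_mono) auto
    with False \<psi>_bounds(2)[of N "cnt (Suc (level Q)) Q"] \<psi>_bounds(1)[of N "cnt (Suc j) Q"]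
    show ?thesis by (simp add: potential_def left_diff_distrib)
  qed
qed

lemma potential_drift:
  assumes P: "valid P" "\<not> has_opt n f P"
    and N: "\<delta> / 2 * (1 / (1 + \<delta> / 2)) ^ N * (\<gamma> * real lam) \<le> 1 / 2"
    and \<epsilon>: "exp (- (\<delta>\<^sup>2 * (\<gamma> * real lam) / 4)) * ((real n + 1) * \<psi> N 0) \<le> 1 / 4"
  shows "(\<integral>\<^sup>+ Q. ennreal (potential N Q) \<partial>ea_step f rate P) + ennreal (1 / 4) \<le> ennreal (potential N P)"
proof -
  define j where "j = level P"
  let ?M = "iid_list lam (offspring P)"
  let ?B = "(real n + 1) * \<psi> N 0"
  let ?drop = "{Q. real (cnt j Q) < \<gamma> * real lam}"
  have B: "0 \<le> ?B" using \<psi>_bounds by simp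
  have cnt_j: "\<gamma> * real lam \<le> real (cnt j P)" using level[OF P(1)] by (simp add: j_def)
  have "j \<noteq> n" using cnt_j no_opt_cnt[OF P] \<gamma>_lam by auto
  then have j: "j < n" using level[OF P(1)] by (simp add: j_def)
  have lt: "real (cnt (Suc j) P) < \<gamma> * real lam"
    using level_ge[of "Suc j" P] j by (force simp: j_def)
  have up: "(\<integral>\<^sup>+ Q. ennreal (\<psi> N (real (cnt (Suc j) Q))) \<partial>?M) + ennreal (1 / 2)
      \<le> ennreal (\<psi> N (real (cnt (Suc j) P)))"
  proof -
    let ?y = "\<delta> / 2 * (1 / (1 + \<delta> / 2)) ^ N * real (cnt (Suc j) P)"
    have "?y \<le> 1 / 2"
      using lt \<delta> by (intro order_trans[OF mult_left_mono N]) auto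
    then have "1 / 2 \<le> exp (- ?y)" using exp_ge_add_one_self[of "- ?y"] by linarith
    then have "(\<integral>\<^sup>+ Q. ennreal (\<psi> N (real (cnt (Suc j) Q))) \<partial>?M) + ennreal (1 / 2)
      \<le> (\<integral>\<^sup>+ Q. ennreal (\<psi> N (real (cnt (Suc j) Q))) \<partial>?M) + ennreal (exp (- ?y))"
      by (intro add_left_mono ennreal_leI)
    also have "\<dots> \<le> ennreal (\<psi> N (real (cnt (Suc j) P)))"
      using level_potential_drift[OF next_level_growth[OF P(1) j cnt_j lt] \<delta> _ _ lam_pos u_def, of N]
        rate \<gamma>_lam lam_pos c by (simp add: cnt_def \<gamma>_def)
    finally show ?thesis .
  qed
  have drop: "ennreal ?B * emeasure ?M ?drop \<le> ennreal (1 / 4)"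
  proof (cases "j = 0")
    case True
    have "emeasure ?M ?drop = 0"
      using True \<gamma>_lam
      by (auto simp: measure_pmf.emeasure_eq_measure measure_pmf_zero_iff set_pmf_iid_list cnt_def threshold_def)
    then show ?thesis by simp
  next
    case False
    have "emeasure ?M ?drop \<le> ennreal (exp (- (\<delta>\<^sup>2 * (\<gamma> * real lam) / 4)))"
      unfolding cnt_def
      using False j level_stable[OF P(1) _ _ cnt_j] \<delta> \<gamma>_lam lam_pos
      by (intro emeasure_iid_list_count_less) auto
    then have "ennreal ?B * emeasure ?M ?drop \<le> ennreal ?B * ennreal (exp (- (\<delta>\<^sup>2 * (\<gamma> * real lam) / 4)))"
      by (intro mult_left_mono) auto
    also have "\<dots> \<le> ennreal (1 / 4)"
      using \<epsilon> B by (subst ennreal_mult[symmetric]) (auto simp: mult.commute intro!: ennreal_leI)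
    finally show ?thesis .
  qed
  have "(\<integral>\<^sup>+ Q. ennreal (potential N Q) \<partial>?M) \<le> (\<integral>\<^sup>+ Q. ennreal (real (n - j) * \<psi> N 0)
      + ennreal (\<psi> N (real (cnt (Suc j) Q))) + ennreal ?B * indicator ?drop Q \<partial>?M)"
  proof (rule nn_integral_mono)
    fix Q
    have "ennreal (potential N Q) \<le> ennreal (real (n - j) * \<psi> N 0 + \<psi> N (real (cnt (Suc j) Q)) + ?B * indicator ?drop Q)"
      by (intro ennreal_leI potential_le_old_level j)
    also have "\<dots> = ennreal (real (n - j) * \<psi> N 0)
      + ennreal (\<psi> N (real (cnt (Suc j) Q))) + ennreal ?B * indicator ?drop Q"
      using \<psi>_bounds B by (auto simp: ennreal_plus[symmetric] simp del: ennreal_plus split: split_indicator)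
    finally show "ennreal (potential N Q) \<le> \<dots>" .
  qed
  also have "\<dots> = ennreal (real (n - j) * \<psi> N 0)
      + (\<integral>\<^sup>+ Q. ennreal (\<psi> N (real (cnt (Suc j) Q))) \<partial>?M) + ennreal ?B * emeasure ?M ?drop"
    by (simp add: nn_integral_add nn_integral_cmult)
  also have "\<dots> \<le> ennreal (real (n - j) * \<psi> N 0)
      + (\<integral>\<^sup>+ Q. ennreal (\<psi> N (real (cnt (Suc j) Q))) \<partial>?M) + ennreal (1 / 4)"
    by (intro add_left_mono drop)
  finally have "(\<integral>\<^sup>+ Q. ennreal (potential N Q) \<partial>?M) + ennreal (1 / 4) \<le> (ennreal (real (n - j) * \<psi> N 0)
      + (\<integral>\<^sup>+ Q. ennreal (\<psi> N (real (cnt (Suc j) Q))) \<partial>?M) + ennreal (1 / 4)) + ennreal (1 / 4)"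
    by (intro add_right_mono)
  also have "\<dots> = ennreal (real (n - j) * \<psi> N 0)
      + ((\<integral>\<^sup>+ Q. ennreal (\<psi> N (real (cnt (Suc j) Q))) \<partial>?M) + (ennreal (1 / 4) + ennreal (1 / 4)))"
    by (simp only: add.assoc)
  also have "ennreal (1 / 4) + ennreal (1 / 4) = ennreal (1 / 2)"
    by (subst ennreal_plus[symmetric]) auto
  also have "ennreal (real (n - j) * \<psi> N 0)
      + ((\<integral>\<^sup>+ Q. ennreal (\<psi> N (real (cnt (Suc j) Q))) \<partial>?M) + ennreal (1 / 2))
      \<le> ennreal (real (n - j) * \<psi> N 0) + ennreal (\<psi> N (real (cnt (Suc j) P)))"
    by (intro add_left_mono up)
  also have "\<dots> = ennreal (potential N P)"
    using \<psi>_bounds by (simp add: potential_def j_def)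
  finally show ?thesis by (simp add: ea_step_eq[OF P(1)])
qed

lemma expected_runtime_bound:
  assumes lam: "4096 / c ^ 3 * fmax\<^sup>2 * ln fmax \<le> real lam"
    and R: "0 \<le> R" "ln (real lam) \<le> R * ln fmax"
    and C: "C = 32 * R / c + 2 + 256 / (c\<^sup>2 * (1 - c))" "8 * C \<le> real n"
  shows "expected_runtime n f rate lam \<le> ennreal (8 * C * (real n * fmax * real lam * ln fmax))"
proof -
  define L where "L = ln fmax"
  have fmax8: "8 < fmax" using fmax_ge n_gt by linarith
  have "exp 1 \<le> fmax" using exp_le fmax8 by linarith
  then have L1: "1 \<le> L" unfolding L_def using ln_ge_iff[OF fmax_pos] by blast
  have L_le: "L \<le> fmax" unfolding L_def using ln_le_minus_one[OF fmax_pos] by simp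
  have lnlam: "0 \<le> ln (real lam)" using lam_pos by simp
  define N where "N = nat \<lceil>4 / \<delta> * ln (real lam)\<rceil>"
  have N_ge: "4 / \<delta> * ln (real lam) \<le> real N" unfolding N_def by linarith
  have N_le: "real N \<le> 4 / \<delta> * ln (real lam) + 1"
    using \<delta> lnlam unfolding N_def by (simp add: of_nat_nat)
  have decay: "\<delta> / 2 * (1 / (1 + \<delta> / 2)) ^ N * (\<gamma> * real lam) \<le> 1 / 2"
  proof -
    have "1 - \<delta> / 4 \<le> exp (- (\<delta> / 4))" using exp_ge_add_one_self[of "- (\<delta> / 4)"] by simp
    moreover have "1 \<le> (1 + \<delta> / 2) * (1 - \<delta> / 4)"
    proof -
      have "\<delta> * \<delta> \<le> \<delta>" using \<delta> by (simp add: mult_left_le)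
      then show ?thesis using \<delta> by (simp add: algebra_simps)
    qed
    moreover have "(1 + \<delta> / 2) * (1 - \<delta> / 4) \<le> (1 + \<delta> / 2) * exp (- (\<delta> / 4))"
      using \<delta> calculation(1) by (intro mult_left_mono) auto
    ultimately have "1 \<le> (1 + \<delta> / 2) * exp (- (\<delta> / 4))" by (blast intro: order_trans)
    then have "1 / (1 + \<delta> / 2) \<le> exp (- (\<delta> / 4))"
      using \<delta> by (simp add: divide_le_eq mult.commute)
    then have "(1 / (1 + \<delta> / 2)) ^ N \<le> exp (- (\<delta> / 4)) ^ N" using \<delta> by (intro power_mono) auto
    also have "\<dots> = exp (- (\<delta> / 4 * real N))" by (simp add: exp_of_nat_mult[symmetric] mult.commute)
    also have "\<dots> \<le> exp (- ln (real lam))" using N_ge \<delta> by (simp add: field_simps)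
    also have "\<dots> = 1 / real lam" using lam_pos by (simp add: exp_minus divide_inverse)
    finally have p: "(1 / (1 + \<delta> / 2)) ^ N \<le> 1 / real lam" .
    have "\<delta> / 2 * (1 / (1 + \<delta> / 2)) ^ N * (\<gamma> * real lam) \<le> 1 / 2 * (1 / real lam) * (1 * real lam)"
      using p \<delta> c lam_pos by (intro mult_mono) (auto simp: \<gamma>_def)
    then show ?thesis using lam_pos by simp
  qed
  have c3: "0 < c ^ 3" "c ^ 3 \<le> 1" using c by (auto intro: power_le_one)
  have u: "1 / u \<le> 256 / (c\<^sup>2 * (1 - c)) * (fmax * L)"
  proof -
    have "1 * fmax\<^sup>2 * 1 \<le> 4096 / c ^ 3 * fmax\<^sup>2 * ln fmax"
      using c3 L1 by (intro mult_mono) (auto simp: L_def pos_le_divide_eq)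
    then have "fmax\<^sup>2 \<le> real lam" using lam by simp
    have "1 / u = 256 / (c\<^sup>2 * (1 - c)) * real n * (fmax\<^sup>2 / real lam)"
      using c fmax_pos n_gt lam_pos
      by (simp add: u_def \<delta>_def \<gamma>_def rate_def field_simps power2_eq_square)
    also have "\<dots> \<le> 256 / (c\<^sup>2 * (1 - c)) * real n * 1"
      using \<open>fmax\<^sup>2 \<le> real lam\<close> c lam_pos by (intro mult_left_mono) (auto simp: divide_le_eq)
    also have "\<dots> \<le> 256 / (c\<^sup>2 * (1 - c)) * (fmax * L)"
    proof -
      have "real n * 1 \<le> fmax * L" using fmax_ge L1 fmax_pos by (intro mult_mono) auto
      then show ?thesis using c by (simp add: divide_right_mono)
    qed
    finally show ?thesis .
  qed
  have "1 \<le> fmax * L" using fmax8 L1 mult_mono[of 1 fmax 1 L] by simp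
  moreover have "4 / \<delta> * ln (real lam) \<le> 32 * R / c * (fmax * L)"
  proof -
    have "4 / \<delta> * ln (real lam) = 32 / c * fmax * ln (real lam)" by (simp add: \<delta>_def)
    also have "\<dots> \<le> 32 / c * fmax * (R * L)"
      using R c fmax_pos by (intro mult_left_mono) (auto simp: L_def)
    finally show ?thesis by (simp add: mult_ac)
  qed
  ultimately have \<psi>: "\<psi> N 0 \<le> C * (fmax * L)"
    using N_le u unfolding level_potential_zero C(1) distrib_right by linarith
  have C_pos: "0 \<le> C" using C(1) R c by simp
  have "real n + 1 \<le> 2 * real n" using n_gt by simp
  then have B: "(real n + 1) * \<psi> N 0 \<le> 2 * real n * (C * (fmax * L))"
    using \<psi> \<psi>_bounds by (intro mult_mono) auto
  have drop: "exp (- (\<delta>\<^sup>2 * (\<gamma> * real lam) / 4)) * ((real n + 1) * \<psi> N 0) \<le> 1 / 4"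
  proof -
    have "4 * L = \<delta>\<^sup>2 * \<gamma> / 4 * (4096 / c ^ 3 * fmax\<^sup>2 * ln fmax)"
      using c fmax_pos by (simp add: L_def \<delta>_def \<gamma>_def field_simps power2_eq_square power3_eq_cube)
    also have "\<dots> \<le> \<delta>\<^sup>2 * \<gamma> / 4 * real lam" using lam c by (intro mult_left_mono) (auto simp: \<gamma>_def)
    finally have "exp (- (\<delta>\<^sup>2 * (\<gamma> * real lam) / 4)) \<le> exp (- (real 4 * L))" by (simp add: mult.assoc)
    also have "\<dots> = inverse (fmax ^ 4)"
      unfolding exp_minus exp_of_nat_mult L_def using fmax_pos by simp
    finally have "exp (- (\<delta>\<^sup>2 * (\<gamma> * real lam) / 4)) * ((real n + 1) * \<psi> N 0)
        \<le> inverse (fmax ^ 4) * (2 * real n * (C * (fmax * L)))"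
      using \<psi>_bounds by (intro mult_mono[OF _ B]) auto
    also have "\<dots> \<le> inverse (fmax ^ 4) * (2 * fmax * (real n / 8 * (fmax * fmax)))"
      using fmax_ge fmax_pos L_le L1 C C_pos by (intro mult_left_mono mult_mono) auto
    also have "\<dots> \<le> inverse (fmax ^ 4) * (2 * fmax * (fmax / 8 * (fmax * fmax)))"
      using fmax_ge fmax_pos by (intro mult_left_mono mult_right_mono) auto
    also have "\<dots> = 1 / 4" using fmax_pos by (simp add: field_simps power4_eq_xxxx)
    finally show ?thesis .
  qed
  have "expected_runtime n f rate lam \<le> ennreal (real lam * ((real n + 1) * \<psi> N 0) / (1 / 4))"
    using valid_init valid_step potential_le potential_drift[OF _ _ decay drop]
    by (intro expected_runtime_le_potential[where V = valid and \<Phi> = "potential N"]) auto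
  also have "\<dots> \<le> ennreal (8 * C * (real n * fmax * real lam * ln fmax))"
  proof (rule ennreal_leI)
    have "real lam * ((real n + 1) * \<psi> N 0) \<le> real lam * (2 * real n * (C * (fmax * L)))"
      using B by (intro mult_left_mono) auto
    then show "real lam * ((real n + 1) * \<psi> N 0) / (1 / 4) \<le> 8 * C * (real n * fmax * real lam * ln fmax)"
      by (simp add: L_def mult_ac)
  qed
  finally show ?thesis .
qed

end

theorem theorem6:
  fixes c :: real
  assumes "0 < c" "c < 1"
  shows "\<exists>c'>0. \<forall>K>0. \<forall>Clam>0. \<exists>C>0. \<exists>N. \<forall>n\<ge>N. \<forall>(a :: nat \<Rightarrow> nat) lam :: nat.
    (\<forall>i j. i \<le> j \<longrightarrow> j < n \<longrightarrow> a j \<le> a i) \<longrightarrow> (\<forall>i<n. 0 < a i) \<longrightarrow>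
    real lam \<ge> c' * real n ^ 2 * real (a 0) ^ 2 * ln (real n * real (a 0)) \<longrightarrow>
    real lam \<le> Clam * (real n * real (a 0)) powr K \<longrightarrow>
    expected_runtime n (lin_fitness a) (((1 - c) / (real n * real (a 0))) / real n) lam
      \<le> ennreal (C * (real n ^ 2 * real (a 0) * real lam * ln (real n * real (a 0))
                     + real n ^ 3 * real (a 0) ^ 2))"
proof (rule exI[of _ "4096 / c ^ 3"], intro conjI allI impI)
  show "0 < 4096 / c ^ 3" using assms by simp
next
  fix K Clam :: real
  assume K: "0 < K" and Clam: "0 < Clam"
  define R where "R = \<bar>ln Clam\<bar> + K"
  define C where "C = 32 * R / c + 2 + 256 / (c\<^sup>2 * (1 - c))"
  have R: "0 \<le> R" using K by (simp add: R_def)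
  then have C: "0 < C" using assms by (simp add: C_def add_nonneg_pos add_pos_nonneg)
  show "\<exists>C>0. \<exists>N. \<forall>n\<ge>N. \<forall>(a :: nat \<Rightarrow> nat) lam :: nat.
    (\<forall>i j. i \<le> j \<longrightarrow> j < n \<longrightarrow> a j \<le> a i) \<longrightarrow> (\<forall>i<n. 0 < a i) \<longrightarrow>
    real lam \<ge> 4096 / c ^ 3 * real n ^ 2 * real (a 0) ^ 2 * ln (real n * real (a 0)) \<longrightarrow>
    real lam \<le> Clam * (real n * real (a 0)) powr K \<longrightarrow>
    expected_runtime n (lin_fitness a) (((1 - c) / (real n * real (a 0))) / real n) lam
      \<le> ennreal (C * (real n ^ 2 * real (a 0) * real lam * ln (real n * real (a 0))
                     + real n ^ 3 * real (a 0) ^ 2))"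
  proof (intro exI[of _ "8 * C"] conjI exI[of _ "nat \<lceil>max (8 / c) (8 * C)\<rceil>"] allI impI)
    show "0 < 8 * C" using C by simp
  next
    fix n lam :: nat and a :: "nat \<Rightarrow> nat"
    assume n: "nat \<lceil>max (8 / c) (8 * C)\<rceil> \<le> n"
      and mono: "\<forall>i j. i \<le> j \<longrightarrow> j < n \<longrightarrow> a j \<le> a i" and pos: "\<forall>i<n. 0 < a i"
      and lam: "4096 / c ^ 3 * real n ^ 2 * real (a 0) ^ 2 * ln (real n * real (a 0)) \<le> real lam"
      and lam_le: "real lam \<le> Clam * (real n * real (a 0)) powr K"
    define M where "M = real n * real (a 0)"
    have "max (8 / c) (8 * C) \<le> real n" using n by linarith
    then have n_ge: "8 / c \<le> real n" and n_C: "8 * C \<le> real n" by auto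
    have "8 < 8 / c" using assms by (simp add: field_simps)
    with n_ge have n8: "8 < real n" by linarith
    have "1 \<le> real (a 0)" using pos n8 by (simp add: Suc_leI)
    then have M8: "8 < M" using n8 mult_left_mono[of 1 "real (a 0)" "real n"] unfolding M_def by linarith
    have "exp 1 \<le> M" using exp_le M8 by linarith
    then have L1: "1 \<le> ln M" using ln_ge_iff[of M 1] M8 by simp
    have lam': "4096 / c ^ 3 * M\<^sup>2 * ln M \<le> real lam"
      using lam by (simp add: M_def power_mult_distrib mult_ac)
    have "0 < 4096 / c ^ 3 * M\<^sup>2 * ln M" using assms M8 L1 by simp
    with lam' have lam_pos: "0 < lam" by linarith
    interpret fp_ea a n lam c
      by unfold_locales (use assms mono pos n_ge lam_pos in auto)
    have fmax: "fmax = M" by (simp add: fmax_def M_def)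
    have "ln (real lam) \<le> ln (Clam * M powr K)"
      using lam_le lam_pos by (simp add: M_def)
    also have "\<dots> = ln Clam + K * ln M" using Clam M8 by (simp add: ln_mult ln_powr)
    also have "\<dots> \<le> \<bar>ln Clam\<bar> * ln M + K * ln M"
      using L1 mult_left_mono[of 1 "ln M" "\<bar>ln Clam\<bar>"] by simp
    finally have lnlam: "ln (real lam) \<le> R * ln M" by (simp add: R_def distrib_right)
    have "expected_runtime n (lin_fitness a) rate lam \<le> ennreal (8 * C * (real n * M * real lam * ln M))"
      using expected_runtime_bound[of R C] lam' lnlam R n_C by (simp add: fmax C_def)
    also have "\<dots> \<le> ennreal (8 * C * (real n ^ 2 * real (a 0) * real lam * ln M + real n ^ 3 * real (a 0) ^ 2))"
      using C by (intro ennreal_leI mult_left_mono) (auto simp: M_def power2_eq_square)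
    finally show "expected_runtime n (lin_fitness a) (((1 - c) / (real n * real (a 0))) / real n) lam
      \<le> ennreal (8 * C * (real n ^ 2 * real (a 0) * real lam * ln (real n * real (a 0))
                     + real n ^ 3 * real (a 0) ^ 2))"
      by (simp only: rate_def fmax_def M_def)
  qed
qed

end
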